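(* The membership problem in the subgroup of $SL_2(\mathbb{Z})$ generated by $A(2)$ and $B(2)$ is solvable in constant time: there is an algorithm which, given a matrix $M \in SL_2(\mathbb{Z})$, decides whether or not $M$ belongs to this subgroup in time bounded by a constant independent of $M$.
   Context: Notation: $A(2) = \begin{pmatrix} 1 & 2 \\ 0 & 1 \end{pmatrix}$ and $B(2) = \begin{pmatrix} 1 & 0 \\ 2 & 1 \end{pmatrix}$. The input matrix is known in advance to belong to $SL_2(\mathbb{Z})$ (the algorithm does not have to check that the determinant is $1$). The entries are given in binary (or, say, decimal) form, and the algorithm may read individual digits of the entries, in particular the last digits, each in constant time. The size of an input matrix is the sum of the absolute values of its entries; "constant time" means time bounded independently of this size. *)

theory Defs
  imports "HOL-Analysis.Analysis" "HOL-Algebra.Generated_Groups"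
begin

type_synonym mat2 = "int ^ 2 ^ 2"

definition SL2Z :: "mat2 monoid" where
  "SL2Z = \<lparr>carrier = {M. det M = 1}, mult = (**), one = mat 1\<rparr>"

definition A :: "int \<Rightarrow> mat2" where
  "A k = vector [vector [1, k], vector [0, 1]]"

definition B :: "int \<Rightarrow> mat2" where
  "B k = vector [vector [1, 0], vector [k, 1]]"

text \<open>
  Entries are written in base \<open>b\<close> in sign-magnitude form. Digit positions are counted from the
  end: position \<open>0\<close> is the last digit. There are no leading zeros (the numeral of \<open>0\<close> is a single
  digit \<open>0\<close>), and a position beyond the leading digit holds a blank, encoded by the non-digit \<open>b\<close>,
  so that a program can detect where the numeral ends.
\<close>

definition digit :: "nat \<Rightarrow> int \<Rightarrow> nat \<Rightarrow> nat" where
  "digit b x i =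
     (if i > 0 \<and> nat \<bar>x\<bar> < b ^ i then b else nat \<bar>x\<bar> div b ^ i mod b)"

text \<open>
  Algorithms are while programs over finitely many natural-number registers with increment,
  decrement and zero test (a Turing-complete language). The input matrix is read-only and can be
  accessed solely by \<open>ReadDigit i j p r\<close>, which stores in \<open>r\<close> the digit of the entry \<open>(i, j)\<close> at the
  position given by the contents of register \<open>p\<close>, and by \<open>ReadSign i j r\<close>.
\<close>

type_synonym reg = nat
type_synonym store = "reg \<Rightarrow> nat"

datatype program =
    Skip
  | Clear reg
  | Inc reg
  | Dec reg
  | ReadDigit 2 2 reg reg
  | ReadSign 2 2 reg
  | Seq program program
  | IfZero reg program program
  | WhileNonzero reg program

text \<open>
  \<open>exec b M c s t s'\<close>: on input \<open>M\<close> written in base \<open>b\<close>, the program \<open>c\<close> started in store \<open>s\<close>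
  halts in store \<open>s'\<close> after \<open>t\<close> steps; every elementary operation and every test is one step.
\<close>

inductive exec :: "nat \<Rightarrow> mat2 \<Rightarrow> program \<Rightarrow> store \<Rightarrow> nat \<Rightarrow> store \<Rightarrow> bool"
  for b :: nat and M :: mat2 where
  Skip: "exec b M Skip s 1 s"
| Clear: "exec b M (Clear r) s 1 (s(r := 0))"
| Inc: "exec b M (Inc r) s 1 (s(r := s r + 1))"
| Dec: "exec b M (Dec r) s 1 (s(r := s r - 1))"
| ReadDigit: "exec b M (ReadDigit i j p r) s 1 (s(r := digit b (M $ i $ j) (s p)))"
| ReadSign: "exec b M (ReadSign i j r) s 1 (s(r := (if M $ i $ j < 0 then 1 else 0)))"
| Seq: "exec b M c s t s' \<Longrightarrow> exec b M d s' u s'' \<Longrightarrow> exec b M (Seq c d) s (t + u) s''"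
| IfZeroTrue: "s r = 0 \<Longrightarrow> exec b M c s t s' \<Longrightarrow> exec b M (IfZero r c d) s (1 + t) s'"
| IfZeroFalse: "s r \<noteq> 0 \<Longrightarrow> exec b M d s t s' \<Longrightarrow> exec b M (IfZero r c d) s (1 + t) s'"
| WhileStop: "s r = 0 \<Longrightarrow> exec b M (WhileNonzero r c) s 1 s"
| WhileStep: "s r \<noteq> 0 \<Longrightarrow> exec b M c s t s' \<Longrightarrow> exec b M (WhileNonzero r c) s' u s'' \<Longrightarrow>
    exec b M (WhileNonzero r c) s (1 + t + u) s''"

text \<open>
  \<open>c\<close> decides membership in \<open>S\<close> for inputs promised to lie in \<open>D\<close>, within \<open>T\<close> steps. All registers
  are initially \<open>0\<close>, and the answer (\<open>1\<close> for yes, \<open>0\<close> for no) is left in register \<open>0\<close>.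
\<close>

definition decides_within :: "nat \<Rightarrow> program \<Rightarrow> nat \<Rightarrow> mat2 set \<Rightarrow> mat2 set \<Rightarrow> bool" where
  "decides_within b c T D S \<longleftrightarrow>
     (\<forall>M\<in>D. \<exists>t s. t \<le> T \<and> exec b M c (\<lambda>_. 0) t s \<and> s 0 = (if M \<in> S then 1 else 0))"

lemma group_SL2Z: "group SL2Z"
proof (rule groupI)
  fix x assume x: "x \<in> carrier SL2Z"
  define y :: mat2 where "y = vector [vector [x$2$2, - x$1$2], vector [- x$2$1, x$1$1]]"
  have "det y = 1" "y ** x = mat 1"
    using x by (auto simp: SL2Z_def y_def det_2 matrix_matrix_mult_def mat_def vec_eq_iff
        forall_2 sum_2 algebra_simps)
  then show "\<exists>y\<in>carrier SL2Z. y \<otimes>\<^bsub>SL2Z\<^esub> x = \<one>\<^bsub>SL2Z\<^esub>"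
    by (auto simp: SL2Z_def)
qed (auto simp: SL2Z_def det_mul matrix_mul_assoc)

lemma generators_in_SL2Z: "A k \<in> carrier SL2Z" "B k \<in> carrier SL2Z"
  by (simp_all add: SL2Z_def A_def B_def det_2)

lemma exec_deterministic:
  "exec b M c s t s' \<Longrightarrow> exec b M c s u s'' \<Longrightarrow> t = u \<and> s' = s''"
proof (induction arbitrary: u s'' rule: exec.induct)
  case (Seq c s t s' d u s'')
  from Seq.prems show ?case by cases (use Seq.IH in blast)
next
  case (WhileStep s r c t s' u s'')
  from WhileStep.prems WhileStep.hyps show ?case
    by cases (use WhileStep.IH in blast)+
qed (erule exec.cases; auto)+

end

theory Submission imports Defs begin

text \<open>
  By Sanov's theorem the subgroup consists of the matrices of determinant \<open>1\<close> whose upper left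
  entry is \<open>1\<close> modulo \<open>4\<close> and whose off-diagonal entries are even (the lower right entry is then
  \<open>1\<close> modulo \<open>4\<close> as well). Such a matrix is reduced to a power of \<open>A(2)\<close> by a Euclidean
  algorithm on its first column: the two entries have different parity, so subtracting or adding
  twice the entry of smaller absolute value decreases the other one. As \<open>4\<close> divides \<open>b\<^sup>2\<close> and
  \<open>2\<close> divides \<open>b\<close>, the congruences depend only on a sign and four digits, each of which takes
  boundedly many values; so a finite decision tree answers the question.
\<close>

section \<open>Sanov's theorem\<close>

definition sanov :: "mat2 set" where
  "sanov = {M. det M = 1 \<and> M $ 1 $ 1 mod 4 = 1 \<and> even (M $ 1 $ 2) \<and> even (M $ 2 $ 1)}"

lemma A_nth [simp]:
  "A k $ 1 $ 1 = 1" "A k $ 1 $ 2 = k" "A k $ 2 $ 1 = 0" "A k $ 2 $ 2 = 1"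
  by (simp_all add: A_def)

lemma B_nth [simp]:
  "B k $ 1 $ 1 = 1" "B k $ 1 $ 2 = 0" "B k $ 2 $ 1 = k" "B k $ 2 $ 2 = 1"
  by (simp_all add: B_def)

lemma mat2_eq_iff:
  "M = N \<longleftrightarrow> M $ 1 $ 1 = N $ 1 $ 1 \<and> M $ 1 $ 2 = N $ 1 $ 2 \<and>
     M $ 2 $ 1 = N $ 2 $ 1 \<and> M $ 2 $ 2 = N $ 2 $ 2" for M N :: mat2
  by (auto simp: vec_eq_iff forall_2)

lemma mat2_mult_nth: "(M ** N) $ i $ j = M $ i $ 1 * N $ 1 $ j + M $ i $ 2 * N $ 2 $ j"
  for M N :: mat2
  by (simp add: matrix_matrix_mult_def sum_2)

lemma A_mult: "A j ** A k = A (j + k)" and B_mult: "B j ** B k = B (j + k)"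
  and A_0: "A 0 = mat 1" and B_0: "B 0 = mat 1"
  by (auto simp: mat2_eq_iff mat2_mult_nth mat_def)

lemma mult_SL2Z: "M \<otimes>\<^bsub>SL2Z\<^esub> N = M ** N" and one_SL2Z: "\<one>\<^bsub>SL2Z\<^esub> = mat 1"
  by (simp_all add: SL2Z_def)

lemma inv_A: "inv\<^bsub>SL2Z\<^esub> (A k) = A (- k)" and inv_B: "inv\<^bsub>SL2Z\<^esub> (B k) = B (- k)"
  by (auto intro!: group.inv_equality[OF group_SL2Z] generators_in_SL2Z
      simp: mult_SL2Z one_SL2Z A_mult B_mult A_0 B_0)

text \<open>Treats both generators at once: \<open>f\<close> is additive in its parameter, so
  multiplying by \<open>f 2\<close> or its inverse walks from \<open>k = 0\<close> in either
  direction.\<close>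

lemma int_multiple_in_generate:
  fixes f :: "int \<Rightarrow> mat2" and k :: int
  assumes "f 2 \<in> S" "inv\<^bsub>SL2Z\<^esub> (f 2) = f (- 2)" "f 0 = mat 1"
    and add: "\<And>j k. f j ** f k = f (j + k)"
  shows "f (2 * k) \<in> generate SL2Z S"
proof (induction k rule: int_induct[where k = 0])
  case base
  show ?case using assms generate.one[of SL2Z S] by (simp add: one_SL2Z)
next
  case (step1 i)
  have "f 2 ** f (2 * i) \<in> generate SL2Z S"
    using step1 assms generate.eng generate.incl mult_SL2Z by metis
  then show ?case by (simp add: add algebra_simps)
next
  case (step2 i)
  have "f (- 2) ** f (2 * i) \<in> generate SL2Z S"
    using step2 assms generate.eng generate.inv mult_SL2Z by metis
  then show ?case by (simp add: add algebra_simps)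
qed

lemma A_in_generate: "A (2 * k) \<in> generate SL2Z {A 2, B 2}"
  and B_in_generate: "B (2 * k) \<in> generate SL2Z {A 2, B 2}"
  by (rule int_multiple_in_generate[of A]; simp add: inv_A A_0 A_mult)
    (rule int_multiple_in_generate[of B]; simp add: inv_B B_0 B_mult)

lemma sanov_one: "mat 1 \<in> sanov"
  by (simp add: sanov_def det_2 mat_def)

lemma A_in_sanov: "even k \<Longrightarrow> A k \<in> sanov" and B_in_sanov: "even k \<Longrightarrow> B k \<in> sanov"
  by (simp_all add: sanov_def det_2)

text \<open>The mixed term in the upper left entry is a product of two even numbers, so modulo
  \<open>4\<close> those entries simply multiply.\<close>

lemma sanov_mult:
  assumes "M \<in> sanov" "N \<in> sanov"
  shows "M ** N \<in> sanov"
proof -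
  have "M $ 1 $ 1 * N $ 1 $ 1 mod 4 = 1"
    using assms mod_mult_eq[of "M $ 1 $ 1" 4 "N $ 1 $ 1"] by (simp add: sanov_def)
  moreover have "4 dvd M $ 1 $ 2 * N $ 2 $ 1"
    using assms mult_dvd_mono[of 2 "M $ 1 $ 2" 2 "N $ 2 $ 1"] by (simp add: sanov_def)
  ultimately have "(M ** N) $ 1 $ 1 mod 4 = 1"
    by (auto simp: mat2_mult_nth elim!: dvdE)
  then show ?thesis using assms by (simp add: sanov_def det_mul mat2_mult_nth)
qed

text \<open>Moving \<open>x\<close> towards \<open>0\<close> by \<open>2 * \<bar>y\<bar>\<close>,
  which is less than \<open>2 * \<bar>x\<bar>\<close>, stops short of \<open>- x\<close>. Hence
  \<open>k = - 1\<close> or \<open>k = 1\<close> suffices, by the sign of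
  \<open>x * y\<close>.\<close>

lemma abs_add_double_less:
  fixes x y :: int
  assumes "y \<noteq> 0" "\<bar>y\<bar> < \<bar>x\<bar>"
  obtains k where "\<bar>x + 2 * k * y\<bar> < \<bar>x\<bar>"
proof (cases "x * y > 0")
  case True
  then have "\<bar>x + 2 * (- 1) * y\<bar> < \<bar>x\<bar>"
    using assms by (auto simp: zero_less_mult_iff)
  then show ?thesis by (rule that)
next
  case False
  then have "\<bar>x + 2 * 1 * y\<bar> < \<bar>x\<bar>"
    using assms by (auto simp: zero_less_mult_iff)
  then show ?thesis by (rule that)
qed

lemma sanov_subset_generate: "M \<in> sanov \<Longrightarrow> M \<in> generate SL2Z {A 2, B 2}"
proof (induction "nat (\<bar>M $ 1 $ 1\<bar> + \<bar>M $ 2 $ 1\<bar>)" arbitrary: M rule: less_induct)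
  case less
  let ?H = "generate SL2Z {A 2, B 2}"
  let ?a = "M $ 1 $ 1" and ?c = "M $ 2 $ 1"
  have a: "?a mod 4 = 1" and c: "even ?c" and det: "?a * M $ 2 $ 2 - M $ 1 $ 2 * ?c = 1"
    using less.prems by (auto simp: sanov_def det_2)
  have "odd ?a" using a by presburger
  \<comment> \<open>Different parities rule out a tie, where the descent would be stuck.\<close>
  then have "\<bar>?a\<bar> \<noteq> \<bar>?c\<bar>" using c by (metis dvd_abs_iff)
  then consider "?c = 0" | "?c \<noteq> 0" "\<bar>?c\<bar> < \<bar>?a\<bar>" | "?a \<noteq> 0" "\<bar>?a\<bar> < \<bar>?c\<bar>"
    using \<open>odd ?a\<close> by fastforce
  then show ?case
  proof cases
    case 1
    \<comment> \<open>The diagonal entries are inverse units; the residue modulo \<open>4\<close>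
      excludes \<open>- 1\<close>.\<close>
    then have "?a = 1" "M $ 2 $ 2 = 1"
      using a det by (auto simp: zmult_eq_1_iff)
    then have "M = A (2 * (M $ 1 $ 2 div 2))"
      using 1 less.prems by (simp add: mat2_eq_iff sanov_def)
    then show ?thesis using A_in_generate by metis
  next
    case 2
    then obtain k where k: "\<bar>?a + 2 * k * ?c\<bar> < \<bar>?a\<bar>" by (rule abs_add_double_less)
    \<comment> \<open>Left multiplication adds \<open>2 * k\<close> times the second row to the
      first, so \<open>?c\<close> is unchanged.\<close>
    let ?N = "A (2 * k) ** M"
    have "?N \<in> ?H"
      using less.prems k by (intro less.hyps sanov_mult A_in_sanov) (auto simp: mat2_mult_nth)
    then have "A (2 * (- k)) ** ?N \<in> ?H"
      using A_in_generate generate.eng mult_SL2Z by metis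
    then show ?thesis by (simp add: matrix_mul_assoc A_mult A_0)
  next
    case 3
    then obtain k where k: "\<bar>?c + 2 * k * ?a\<bar> < \<bar>?c\<bar>" by (rule abs_add_double_less)
    let ?N = "B (2 * k) ** M"
    have "?N \<in> ?H"
      using less.prems k
      by (intro less.hyps sanov_mult B_in_sanov) (auto simp: mat2_mult_nth add.commute)
    then have "B (2 * (- k)) ** ?N \<in> ?H"
      using B_in_generate generate.eng mult_SL2Z by metis
    then show ?thesis by (simp add: matrix_mul_assoc B_mult B_0)
  qed
qed

theorem generate_eq_sanov: "generate SL2Z {A 2, B 2} = sanov"
proof (intro subset_antisym subsetI)
  fix M assume "M \<in> generate SL2Z {A 2, B 2}"
  then show "M \<in> sanov"
    by induction
      (auto simp: one_SL2Z mult_SL2Z inv_A inv_B sanov_one A_in_sanov B_in_sanov sanov_mult)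
qed (rule sanov_subset_generate)

section \<open>Constant-time decision trees\<close>

text \<open>
  Programs start in an arbitrary store here, so that they can be composed.
\<close>

definition const_time :: "nat \<Rightarrow> mat2 set \<Rightarrow> mat2 set \<Rightarrow> bool" where
  "const_time b D S \<longleftrightarrow> (\<exists>c T. \<forall>M\<in>D. \<forall>s. \<exists>t s'. t \<le> T \<and> exec b M c s t s' \<and>
     s' 0 = (if M \<in> S then 1 else 0))"

text \<open>The leaves of the tree: the answer is fixed, so nothing is read. This includes
  impossible branches, where \<open>D\<close> is empty.\<close>

lemma const_time_constant:
  assumes "D \<subseteq> S \<or> D \<inter> S = {}"
  shows "const_time b D S"
proof -
  have 0: "exec b M (Clear 0) s 1 (s(0 := 0))" for M s
    by (rule exec.Clear)
  have "exec b M (Seq (Clear 0) (Inc 0)) s (1 + 1) (s(0 := 0, 0 := (s(0 := 0)) 0 + 1))" for M s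
    by (rule exec.Seq[OF exec.Clear exec.Inc])
  then have 1: "exec b M (Seq (Clear 0) (Inc 0)) s 2 (s(0 := 1))" for M s
    by (simp add: numeral_2_eq_2)
  from assms show ?thesis
  proof
    assume "D \<subseteq> S"
    then have "\<forall>M\<in>D. \<forall>s. \<exists>t s'. t \<le> 2 \<and> exec b M (Seq (Clear 0) (Inc 0)) s t s' \<and>
        s' 0 = (if M \<in> S then 1 else 0)"
      using 1 by (metis fun_upd_same order_refl subsetD)
    then show ?thesis unfolding const_time_def by blast
  next
    assume "D \<inter> S = {}"
    then have "\<forall>M\<in>D. \<forall>s. \<exists>t s'. t \<le> 1 \<and> exec b M (Clear 0) s t s' \<and>
        s' 0 = (if M \<in> S then 1 else 0)"
      using 0 by (metis disjoint_iff fun_upd_same order_refl)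
    then show ?thesis unfolding const_time_def by blast
  qed
qed

text \<open>A multiway branch on register \<open>r\<close>, built as a chain of zero tests and
  decrements. Each link adds at most two steps.\<close>

lemma branching_program:
  assumes "\<And>k. k < n \<Longrightarrow> const_time b (D k) S"
  shows "\<exists>c T. \<forall>k<n. \<forall>M\<in>D k. \<forall>s. s r = k \<longrightarrow>
    (\<exists>t s'. t \<le> T \<and> exec b M c s t s' \<and> s' 0 = (if M \<in> S then 1 else 0))"
  using assms
proof (induction n arbitrary: D)
  case 0
  show ?case by simp
next
  case (Suc n)
  obtain c T where c: "\<And>M s. M \<in> D 0 \<Longrightarrow> \<exists>t s'. t \<le> T \<and> exec b M c s t s' \<and>
      s' 0 = (if M \<in> S then 1 else 0)"
    using Suc.prems[OF zero_less_Suc] unfolding const_time_def by blast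
  obtain d U where d: "\<And>k M s. k < n \<Longrightarrow> M \<in> D (Suc k) \<Longrightarrow> s r = k \<Longrightarrow>
      \<exists>t s'. t \<le> U \<and> exec b M d s t s' \<and> s' 0 = (if M \<in> S then 1 else 0)"
    using Suc.IH[of "\<lambda>k. D (Suc k)"] Suc.prems by (metis Suc_less_eq)
  let ?c = "IfZero r c (Seq (Dec r) d)"
  have "\<exists>t s'. t \<le> T + U + 2 \<and> exec b M ?c s t s' \<and> s' 0 = (if M \<in> S then 1 else 0)"
    if "s r < Suc n" "M \<in> D (s r)" for M s
  proof (cases "s r")
    case 0
    then have "M \<in> D 0" using that by simp
    then obtain t s' where "t \<le> T" "exec b M c s t s'" "s' 0 = (if M \<in> S then 1 else 0)"
      using c[of M s] by blast
    then show ?thesis using exec.IfZeroTrue[of s r b M c t s'] 0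
      by (intro exI[of _ "1 + t"] exI[of _ s']) auto
  next
    case (Suc k)
    then have "k < n" "M \<in> D (Suc k)" "(s(r := s r - 1)) r = k" using that by simp_all
    then obtain t s' where "t \<le> U" "exec b M d (s(r := s r - 1)) t s'"
      "s' 0 = (if M \<in> S then 1 else 0)"
      using d by blast
    then show ?thesis
      using exec.IfZeroFalse[of s r b M "Seq (Dec r) d" "1 + t" s'] exec.Seq[OF exec.Dec] Suc
      by (intro exI[of _ "1 + (1 + t)"] exI[of _ s']) auto
  qed
  then show ?case by blast
qed

text \<open>An inner node of the tree. The reading program may overwrite any register, since the
  branches work from every store.\<close>

lemma const_time_query:
  assumes read: "\<And>M s. M \<in> D \<Longrightarrow> \<exists>s'. exec b M c s u s' \<and> s' r = q M"
    and bound: "\<And>M. M \<in> D \<Longrightarrow> q M < n"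
    and cases: "\<And>k. const_time b {M \<in> D. q M = k} S"
  shows "const_time b D S"
proof -
  obtain d T where d: "\<And>M s. M \<in> D \<Longrightarrow> s r = q M \<Longrightarrow>
      \<exists>t s'. t \<le> T \<and> exec b M d s t s' \<and> s' 0 = (if M \<in> S then 1 else 0)"
    using branching_program[of n b "\<lambda>k. {M \<in> D. q M = k}" S r] cases bound by blast
  have "\<exists>t s'. t \<le> u + T \<and> exec b M (Seq c d) s t s' \<and> s' 0 = (if M \<in> S then 1 else 0)"
    if M: "M \<in> D" for M s
  proof -
    obtain s1 where s1: "exec b M c s u s1" "s1 r = q M" using read[OF M] by blast
    obtain t s2 where "t \<le> T" "exec b M d s1 t s2" "s2 0 = (if M \<in> S then 1 else 0)"
      using d[of M s1] M s1(2) by blast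
    then show ?thesis using exec.Seq[OF s1(1)] by (meson add_left_mono)
  qed
  then show ?thesis unfolding const_time_def by blast
qed

lemma const_time_digit:
  assumes "b > 0" "\<And>k. const_time b {M \<in> D. digit b (M $ i $ j) p = k} S"
  shows "const_time b D S"
proof (rule const_time_query)
  \<comment> \<open>The position is a fixed number, so it is loaded by \<open>p\<close> increments;
    register \<open>0\<close> then receives the digit itself.\<close>
  let ?set = "((\<lambda>c. Seq c (Inc 0)) ^^ p) (Clear 0)"
  fix M s
  have "exec b M ?set s (Suc p) (s(0 := p))"
  proof (induction p)
    case 0
    show ?case using exec.Clear[of b M 0 s] by (simp add: fun_upd_def)
  next
    case (Suc p)
    have "exec b M (Seq (((\<lambda>c. Seq c (Inc 0)) ^^ p) (Clear 0)) (Inc 0)) s (Suc p + 1)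
        (s(0 := p, 0 := (s(0 := p)) 0 + 1))"
      by (rule exec.Seq[OF Suc exec.Inc])
    then show ?case by (simp only: funpow.simps comp_apply fun_upd_same fun_upd_upd flip: Suc_eq_plus1)
  qed
  from exec.Seq[OF this exec.ReadDigit[of b M i j 0 0]]
  show "\<exists>s'. exec b M (Seq ?set (ReadDigit i j 0 0)) s (Suc p + 1) s' \<and>
      s' 0 = digit b (M $ i $ j) p"
    by (metis fun_upd_same)
next
  \<comment> \<open>The value \<open>b\<close> itself occurs, as the blank.\<close>
  show "digit b (M $ i $ j) p < Suc b" for M
    using \<open>b > 0\<close> by (simp add: digit_def less_Suc_eq)
qed (rule assms)

lemma const_time_sign:
  assumes "const_time b {M \<in> D. M $ i $ j < 0} S" "const_time b {M \<in> D. M $ i $ j \<ge> 0} S"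
  shows "const_time b D S"
proof (rule const_time_query)
  let ?q = "\<lambda>M :: mat2. if M $ i $ j < 0 then 1 else 0 :: nat"
  show "\<exists>s'. exec b M (ReadSign i j 0) s 1 s' \<and> s' 0 = ?q M" for M s
    by (metis exec.ReadSign fun_upd_same)
  show "?q M < 2" for M by simp
  fix k :: nat
  have "{M \<in> D. ?q M = k} = (if k = 0 then {M \<in> D. M $ i $ j \<ge> 0}
      else if k = 1 then {M \<in> D. M $ i $ j < 0} else {})"
    by auto
  then show "const_time b {M \<in> D. ?q M = k} S"
    using assms by (simp add: const_time_constant)
qed

section \<open>Congruences from the last digits\<close>

text \<open>
  A blank at position \<open>1\<close> is read as \<open>b\<close>; its contribution \<open>2 * b\<close> vanishes modulo \<open>4\<close>, so it
  needs no separate treatment.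
\<close>

lemma abs_mod_4_digits:
  assumes "b \<in> {2, 10}"
  shows "nat \<bar>x\<bar> mod 4 = (digit b x 0 + 2 * digit b x 1) mod 4"
proof -
  let ?n = "nat \<bar>x\<bar>"
  have b: "2 dvd b" using assms by auto
  have d: "digit b x 1 mod 2 = ?n div b mod 2"
    using b assms by (auto simp: digit_def mod_mod_cancel)
  \<comment> \<open>Both bases are \<open>2\<close> modulo \<open>4\<close>, whence the weight
    \<open>2\<close> of the second digit.\<close>
  obtain m where m: "b = 2 + 4 * m"
    using assms by (auto intro: that[of 0] that[of 2])
  have "?n = b * (?n div b) + ?n mod b" by simp
  also have "\<dots> = ?n mod b + 2 * (?n div b) + 4 * (m * (?n div b))"
    by (subst (1) m) (simp add: distrib_right)
  finally have "?n mod 4 = (?n mod b + 2 * (?n div b)) mod 4"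
    by (metis mod_mult_self2)
  \<comment> \<open>After doubling, only the parity of the digit matters modulo
    \<open>4\<close>.\<close>
  also have "\<dots> = (?n mod b + 2 * digit b x 1) mod 4"
    using arg_cong[OF d, of "(*) 2"] by (intro mod_add_cong refl) (simp add: mult_mod_right)
  finally show ?thesis by (simp add: digit_def)
qed

lemma even_digit:
  assumes "b \<in> {2, 10}"
  shows "even x \<longleftrightarrow> even (digit b x 0)"
proof -
  have "even x \<longleftrightarrow> even (nat \<bar>x\<bar>)" by (simp add: even_nat_iff)
  also have "\<dots> \<longleftrightarrow> even (nat \<bar>x\<bar> mod b)" using assms by (auto simp: dvd_mod_iff)
  finally show ?thesis by (simp add: digit_def)
qed

text \<open>Digits show only the absolute value; negation swaps the residues \<open>1\<close> and
  \<open>3\<close>.\<close>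

lemma mod_4_eq_1_iff: "x mod 4 = 1 \<longleftrightarrow> nat \<bar>x\<bar> mod 4 = (if x < 0 then 3 else 1)" for x :: int
proof (cases x rule: int_cases2)
  case (nonneg n)
  have "int n mod 4 = 1 \<longleftrightarrow> n mod 4 = 1" by presburger
  then show ?thesis using nonneg by simp
next
  case (nonpos n)
  have "- int n mod 4 = 1 \<longleftrightarrow> n mod 4 = 3" by presburger
  then show ?thesis using nonpos by (cases "n = 0") simp_all
qed

theorem corollary2:
  fixes b :: nat
  assumes "b \<in> {2, 10}"
  shows "\<exists>c T. decides_within b c T (carrier SL2Z) (generate SL2Z {A 2, B 2})"
proof -
  have b: "b > 0" using assms by auto
  \<comment> \<open>Once the sign and the four digits are fixed, Sanov's congruences hold on all of
    \<open>D\<close> or nowhere on it.\<close>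
  have leaf: "const_time b D sanov"
    if D: "\<And>M. M \<in> D \<Longrightarrow> det M = 1 \<and> (M $ 1 $ 1 < 0 \<longleftrightarrow> neg) \<and> digit b (M $ 1 $ 1) 0 = d0 \<and>
      digit b (M $ 1 $ 1) 1 = d1 \<and> digit b (M $ 1 $ 2) 0 = e \<and> digit b (M $ 2 $ 1) 0 = f"
    for D neg d0 d1 e f
  proof (rule const_time_constant)
    have "M \<in> sanov \<longleftrightarrow> (d0 + 2 * d1) mod 4 = (if neg then 3 else 1) \<and> even e \<and> even f"
      if "M \<in> D" for M
      using D[OF that] by (auto simp: sanov_def mod_4_eq_1_iff abs_mod_4_digits[OF assms]
          even_digit[OF assms])
    then show "D \<subseteq> sanov \<or> D \<inter> sanov = {}" by blast
  qed
  \<comment> \<open>Four digit queries, then one sign query; the values along a branch instantiate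
    the parameters of \<open>leaf\<close>.\<close>
  have "const_time b (carrier SL2Z) sanov"
    apply (rule const_time_digit[OF b, where i = 1 and j = 1 and p = 0])
    apply (rule const_time_digit[OF b, where i = 1 and j = 1 and p = 1])
    apply (rule const_time_digit[OF b, where i = 1 and j = 2 and p = 0])
    apply (rule const_time_digit[OF b, where i = 2 and j = 1 and p = 0])
    apply (rule const_time_sign[where i = 1 and j = 1])
     apply (rule leaf[where neg = True]; auto simp: SL2Z_def)
    apply (rule leaf[where neg = False]; auto simp: SL2Z_def)
    done
  then show ?thesis
    unfolding const_time_def decides_within_def generate_eq_sanov by blast
qed

end
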